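(* Let $G$ be a finite group, $\alpha\in Z^3(G,k^* )$ a normalised 3-cocycle, $H\subset G$ a subgroup and $\gamma\in C^2(H,k^* )$ with $d(\gamma)=\alpha|_H$. Let $L=L(H,\gamma)$ be the corresponding Lagrangian algebra in $\mathcal{Z}(G,\alpha)$. Then the character $\chi_L$ has the form $$\chi_L(f,g)=\sum_{y\in Y}\frac{\alpha(y^{-1}gy,y^{-1}|f)\,\gamma(y^{-1}gy,y^{-1}fy)}{\alpha(y^{-1},g|f)\,\gamma(y^{-1}fy,y^{-1}gy)},\qquad f,g\in G,\ fg=gf,$$ where $Y$ is a set of representatives in $G$ of the cosets from $\{y\in G\mid y^{-1}fy\in H,\ y^{-1}gy\in H\}/H\subset G/H$.
   Context: $k$ is an algebraically closed field of characteristic zero, $k^*$ its multiplicative group; vector spaces are finite dimensional. Normalised 3-cocycles of $G$ are functions $\alpha:G^3\to k^*$ with $\alpha(g,h,l)\alpha(f,gh,l)\alpha(f,g,h)=\alpha(fg,h,l)\alpha(f,g,hl)$ and $\alpha(f,g,h)=1$ whenever one of $f,g,h$ is the identity $e$. With ${}^{g}h=ghg^{-1}$ put $$\alpha(f,g|h)=\alpha(f,g,h)^{-1}\alpha(f,{}^{g}h,g)\alpha({}^{fg}h,f,g)^{-1},\qquad \alpha(f|g,h)=\alpha(f,g,h)\alpha({}^{f}g,f,h)^{-1}\alpha({}^{f}g,{}^{f}h,f).$$ The braided monoidal category $\mathcal{Z}(G,\alpha)$ (and likewise $\mathcal{Z}(H,\alpha|_H)$): objects are $G$-graded vector spaces $X=\bigoplus_gX_g$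 with an $\alpha$-projective $G$-action, i.e. automorphisms $v\mapsto f.v$ with $f.X_g=X_{fgf^{-1}}$ and $(fg).v=\alpha(f,g|h)\,f.(g.v)$ for $v\in X_h$; morphisms preserve grading and action. Tensor product: graded tensor product with $f.(x\otimes y)=\alpha(f|g,h)(f.x\otimes f.y)$ for $x\in X_g,y\in Y_h$; associativity constraint $u\otimes(v\otimes w)\mapsto\alpha(f,g,h)(u\otimes v)\otimes w$ for degrees $f,g,h$; unit $k$ in degree $e$; braiding $c_{X,Y}(x\otimes y)=f.y\otimes x$ for $x\in X_f$. The character of $Z\in\mathcal{Z}(G,\alpha)$ is the function on commuting pairs $f,g\in G$ given by $\chi_Z(f,g)=\mathrm{Tr}_{Z_f}(g)$, the trace of $z\mapsto g.z$ on $Z_f$. A commutative algebra $L$ is Lagrangian if every local right $L$-module (a module $(M,\nu)$ with $\nu\circ c_{L,M}\circ c_{M,L}=\nu$) is a direct sum of copies of $L$. $C^2(H,k^* )$: normalised 2-cochains $H\times H\to k^*$; $d(\gamma)(f,g,h)=\gamma(g,h)\gamma(fg,h)^{-1}\gamma(f,gh)\gamma(f,g)^{-1}$. $k[H,\gamma]$ is the algebra in $\mathcal{Z}(H,\alpha|_H)$ with basis $e_f$, $f\in H$, of degree $f$, multiplication $e_fe_g=\gamma(f,g)e_{fg}$ and $H$-action $h.e_f=\frac{\gamma(h,f)}{\gamma(hfh^{-1},h)}e_{hfh^{-1}}$. For $V\in\mathcal{Z}(H,\alpha|_H)$ (viewed as $G$-graded with zero components outside $H$) let $E(V)=\bigoplus_{f\in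 G}E(V)_f\in\mathcal{Z}(G,\alpha)$, where $E(V)_f$ is the space of maps $a:G\to V$ with $a(x)\in V_{x^{-1}fx}$ and $a(xh)=\alpha(h^{-1},x^{-1}|f)\,h^{-1}.a(x)$ for all $x\in G,h\in H$, with $G$-action $(g.a)(x)=\alpha(x^{-1},g|f)^{-1}a(g^{-1}x)$ for $a\in E(V)_f$. If $B$ is an algebra in $\mathcal{Z}(H,\alpha|_H)$, then $E(B)$ is an algebra in $\mathcal{Z}(G,\alpha)$ with $(ab)(x)=\alpha(x^{-1}|f,g)\,a(x)b(x)$ for $a\in E(B)_f,b\in E(B)_g$. Define $L(H,\gamma)=E(k[H,\gamma])$. *)

theory Defs
  imports
    "HOL-Algebra.Coset"
    "HOL-Computational_Algebra.Polynomial"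
    "HOL-Library.Function_Algebras"
begin

section \<open>Cochains\<close>

definition normalised_3cocycle ::
    "('g, 'm) monoid_scheme \<Rightarrow> ('g \<Rightarrow> 'g \<Rightarrow> 'g \<Rightarrow> 'k::field) \<Rightarrow> bool" where
  "normalised_3cocycle G \<alpha> \<longleftrightarrow>
    (\<forall>f\<in>carrier G. \<forall>g\<in>carrier G. \<forall>h\<in>carrier G. \<alpha> f g h \<noteq> 0) \<and>
    (\<forall>f\<in>carrier G. \<forall>g\<in>carrier G. \<forall>h\<in>carrier G. \<forall>l\<in>carrier G.
      \<alpha> g h l * \<alpha> f (g \<otimes>\<^bsub>G\<^esub> h) l * \<alpha> f g h = \<alpha> (f \<otimes>\<^bsub>G\<^esub> g) h l * \<alpha> f g (h \<otimes>\<^bsub>G\<^esub> l)) \<and>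
    (\<forall>f\<in>carrier G. \<forall>g\<in>carrier G. \<forall>h\<in>carrier G.
      f = \<one>\<^bsub>G\<^esub> \<or> g = \<one>\<^bsub>G\<^esub> \<or> h = \<one>\<^bsub>G\<^esub> \<longrightarrow> \<alpha> f g h = 1)"

definition normalised_2cochain ::
    "('g, 'm) monoid_scheme \<Rightarrow> ('g \<Rightarrow> 'g \<Rightarrow> 'k::field) \<Rightarrow> bool" where
  "normalised_2cochain H \<gamma> \<longleftrightarrow>
    (\<forall>f\<in>carrier H. \<forall>g\<in>carrier H. \<gamma> f g \<noteq> 0) \<and>
    (\<forall>f\<in>carrier H. \<forall>g\<in>carrier H. f = \<one>\<^bsub>H\<^esub> \<or> g = \<one>\<^bsub>H\<^esub> \<longrightarrow> \<gamma> f g = 1)"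

definition coboundary2 ::
    "('g, 'm) monoid_scheme \<Rightarrow> ('g \<Rightarrow> 'g \<Rightarrow> 'k::field) \<Rightarrow> 'g \<Rightarrow> 'g \<Rightarrow> 'g \<Rightarrow> 'k" where
  "coboundary2 G \<gamma> f g h =
    \<gamma> g h * inverse (\<gamma> (f \<otimes>\<^bsub>G\<^esub> g) h) * \<gamma> f (g \<otimes>\<^bsub>G\<^esub> h) * inverse (\<gamma> f g)"

definition conj_by :: "('g, 'm) monoid_scheme \<Rightarrow> 'g \<Rightarrow> 'g \<Rightarrow> 'g" where
  "conj_by G g h = g \<otimes>\<^bsub>G\<^esub> h \<otimes>\<^bsub>G\<^esub> inv\<^bsub>G\<^esub> g"

text \<open>\<open>coc_act G \<alpha> f g h\<close> is \<open>\<alpha>(f,g|h)\<close>, and \<open>coc_ten G \<alpha> f g h\<close> is \<open>\<alpha>(f|g,h)\<close>.\<close>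

definition coc_act ::
    "('g, 'm) monoid_scheme \<Rightarrow> ('g \<Rightarrow> 'g \<Rightarrow> 'g \<Rightarrow> 'k::field) \<Rightarrow> 'g \<Rightarrow> 'g \<Rightarrow> 'g \<Rightarrow> 'k" where
  "coc_act G \<alpha> f g h =
    inverse (\<alpha> f g h) * \<alpha> f (conj_by G g h) g * inverse (\<alpha> (conj_by G (f \<otimes>\<^bsub>G\<^esub> g) h) f g)"

definition coc_ten ::
    "('g, 'm) monoid_scheme \<Rightarrow> ('g \<Rightarrow> 'g \<Rightarrow> 'g \<Rightarrow> 'k::field) \<Rightarrow> 'g \<Rightarrow> 'g \<Rightarrow> 'g \<Rightarrow> 'k" where
  "coc_ten G \<alpha> f g h =
    \<alpha> f g h * inverse (\<alpha> (conj_by G f g) f h) * \<alpha> (conj_by G f g) (conj_by G f h) f"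


section \<open>Objects and algebras of \<open>Z(G,\<alpha>)\<close>\<close>

text \<open>A graded vector space is stored as the family of its homogeneous components, each a
  subspace of one ambient vector space \<open>'v\<close>; it stands for their external direct sum. All
  operations are given on homogeneous elements and carry the degrees as arguments:
  \<open>zact X g f v\<close> is \<open>g.v\<close> for \<open>v \<in> X\<^sub>f\<close>, and \<open>zmul B f g v w\<close> is \<open>vw\<close> for
  \<open>v \<in> B\<^sub>f\<close> and \<open>w \<in> B\<^sub>g\<close>.\<close>

record ('g, 'k, 'v) zobj =
  zscale :: "'k \<Rightarrow> 'v \<Rightarrow> 'v"
  zcomp :: "'g \<Rightarrow> 'v set"
  zact :: "'g \<Rightarrow> 'g \<Rightarrow> 'v \<Rightarrow> 'v"

record ('g, 'k, 'v) zalg = "('g, 'k, 'v) zobj" +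
  zmul :: "'g \<Rightarrow> 'g \<Rightarrow> 'v \<Rightarrow> 'v \<Rightarrow> 'v"

definition z_object ::
    "('g, 'm) monoid_scheme \<Rightarrow> ('g \<Rightarrow> 'g \<Rightarrow> 'g \<Rightarrow> 'k::field) \<Rightarrow>
      ('g, 'k, 'v::ab_group_add, 'z) zobj_scheme \<Rightarrow> bool" where
  "z_object G \<alpha> X \<longleftrightarrow>
    vector_space (zscale X) \<and>
    (\<forall>h\<in>carrier G. module.subspace (zscale X) (zcomp X h) \<and>
      (\<exists>B. finite B \<and> zcomp X h \<subseteq> module.span (zscale X) B)) \<and>
    (\<forall>f\<in>carrier G. \<forall>h\<in>carrier G.
      bij_betw (zact X f h) (zcomp X h) (zcomp X (conj_by G f h)) \<and>
      (\<forall>v\<in>zcomp X h. \<forall>w\<in>zcomp X h. zact X f h (v + w) = zact X f h v + zact X f h w) \<and>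
      (\<forall>c. \<forall>v\<in>zcomp X h. zact X f h (zscale X c v) = zscale X c (zact X f h v))) \<and>
    (\<forall>f\<in>carrier G. \<forall>g\<in>carrier G. \<forall>h\<in>carrier G. \<forall>v\<in>zcomp X h.
      zact X (f \<otimes>\<^bsub>G\<^esub> g) h v =
        zscale X (coc_act G \<alpha> f g h) (zact X f (conj_by G g h) (zact X g h v)))"

text \<open>Trace of a linear operator \<open>T\<close> on a finite dimensional subspace \<open>S\<close>: the sum of the
  diagonal entries of its matrix. The choice of basis is immaterial, see \<open>trace_on_eq\<close>.\<close>

definition trace_on ::
    "('k::field \<Rightarrow> 'v::ab_group_add \<Rightarrow> 'v) \<Rightarrow> 'v set \<Rightarrow> ('v \<Rightarrow> 'v) \<Rightarrow> 'k" where
  "trace_on s S T =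
    (let B = (SOME B. \<not> module.dependent s B \<and> module.span s B = S)
     in \<Sum>b\<in>B. module.representation s B (T b) b)"

definition zcharacter ::
    "('g, 'k::field, 'v::ab_group_add, 'z) zobj_scheme \<Rightarrow> 'g \<Rightarrow> 'g \<Rightarrow> 'k" where
  "zcharacter X f g = trace_on (zscale X) (zcomp X f) (zact X g f)"


section \<open>The algebra \<open>L(H,\<gamma>)\<close>\<close>

text \<open>\<open>k[H,\<gamma>]\<close>, with the function \<open>v\<close> standing for \<open>\<Sum>\<^sub>f v(f) e\<^sub>f\<close>.\<close>

definition tw_basis :: "'g \<Rightarrow> 'g \<Rightarrow> 'k::field" where
  "tw_basis f = (\<lambda>x. if x = f then 1 else 0)"

definition tw_group_alg ::
    "('g, 'm) monoid_scheme \<Rightarrow> ('g \<Rightarrow> 'g \<Rightarrow> 'k::field) \<Rightarrow> ('g, 'k, 'g \<Rightarrow> 'k) zalg" where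
  "tw_group_alg H \<gamma> =
    \<lparr> zscale = (\<lambda>c v x. c * v x),
      zcomp = (\<lambda>f. {v. \<exists>c. v = (\<lambda>x. c * tw_basis f x)}),
      zact = (\<lambda>h f v x. v f * (\<gamma> h f / \<gamma> (conj_by H h f) h) * tw_basis (conj_by H h f) x),
      zmul = (\<lambda>f g v w x. v f * w g * \<gamma> f g * tw_basis (f \<otimes>\<^bsub>H\<^esub> g) x) \<rparr>"

text \<open>An \<open>H\<close>-graded algebra viewed as a \<open>G\<close>-graded one, with zero components outside \<open>H\<close>.\<close>

definition zext_comp :: "'g set \<Rightarrow> ('g, 'k, 'v::zero, 'z) zobj_scheme \<Rightarrow> 'g \<Rightarrow> 'v set" where
  "zext_comp H V f = (if f \<in> H then zcomp V f else {0})"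

definition zext_act :: "'g set \<Rightarrow> ('g, 'k, 'v::zero, 'z) zobj_scheme \<Rightarrow> 'g \<Rightarrow> 'g \<Rightarrow> 'v \<Rightarrow> 'v" where
  "zext_act H V h f v = (if f \<in> H then zact V h f v else 0)"

definition zext_mul ::
    "'g set \<Rightarrow> ('g, 'k, 'v::zero, 'z) zalg_scheme \<Rightarrow> 'g \<Rightarrow> 'g \<Rightarrow> 'v \<Rightarrow> 'v \<Rightarrow> 'v" where
  "zext_mul H B f g v w = (if f \<in> H \<and> g \<in> H then zmul B f g v w else 0)"

text \<open>Maps \<open>a : G \<rightarrow> V\<close> are represented by total functions vanishing outside \<open>carrier G\<close>.\<close>

definition E_comp ::
    "('g, 'm) monoid_scheme \<Rightarrow> 'g set \<Rightarrow> ('g \<Rightarrow> 'g \<Rightarrow> 'g \<Rightarrow> 'k::field) \<Rightarrow>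
      ('g, 'k, 'v::ab_group_add, 'z) zobj_scheme \<Rightarrow> 'g \<Rightarrow> ('g \<Rightarrow> 'v) set" where
  "E_comp G H \<alpha> V f =
    {a. (\<forall>x. x \<notin> carrier G \<longrightarrow> a x = 0) \<and>
        (\<forall>x\<in>carrier G. a x \<in> zext_comp H V (conj_by G (inv\<^bsub>G\<^esub> x) f)) \<and>
        (\<forall>x\<in>carrier G. \<forall>h\<in>H.
          a (x \<otimes>\<^bsub>G\<^esub> h) =
            zscale V (coc_act G \<alpha> (inv\<^bsub>G\<^esub> h) (inv\<^bsub>G\<^esub> x) f)
              (zext_act H V (inv\<^bsub>G\<^esub> h) (conj_by G (inv\<^bsub>G\<^esub> x) f) (a x)))}"

definition E_act ::
    "('g, 'm) monoid_scheme \<Rightarrow> ('g \<Rightarrow> 'g \<Rightarrow> 'g \<Rightarrow> 'k::field) \<Rightarrow>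
      ('g, 'k, 'v::ab_group_add, 'z) zobj_scheme \<Rightarrow> 'g \<Rightarrow> 'g \<Rightarrow> ('g \<Rightarrow> 'v) \<Rightarrow> 'g \<Rightarrow> 'v" where
  "E_act G \<alpha> V g f a =
    (\<lambda>x. if x \<in> carrier G
         then zscale V (inverse (coc_act G \<alpha> (inv\<^bsub>G\<^esub> x) g f)) (a (inv\<^bsub>G\<^esub> g \<otimes>\<^bsub>G\<^esub> x))
         else 0)"

definition E_mul ::
    "('g, 'm) monoid_scheme \<Rightarrow> 'g set \<Rightarrow> ('g \<Rightarrow> 'g \<Rightarrow> 'g \<Rightarrow> 'k::field) \<Rightarrow>
      ('g, 'k, 'v::ab_group_add, 'z) zalg_scheme \<Rightarrow> 'g \<Rightarrow> 'g \<Rightarrow> ('g \<Rightarrow> 'v) \<Rightarrow> ('g \<Rightarrow> 'v) \<Rightarrow> 'g \<Rightarrow> 'v" where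
  "E_mul G H \<alpha> B f g a b =
    (\<lambda>x. if x \<in> carrier G
         then zscale B (coc_ten G \<alpha> (inv\<^bsub>G\<^esub> x) f g)
           (zext_mul H B (conj_by G (inv\<^bsub>G\<^esub> x) f) (conj_by G (inv\<^bsub>G\<^esub> x) g) (a x) (b x))
         else 0)"

definition E_alg ::
    "('g, 'm) monoid_scheme \<Rightarrow> 'g set \<Rightarrow> ('g \<Rightarrow> 'g \<Rightarrow> 'g \<Rightarrow> 'k::field) \<Rightarrow>
      ('g, 'k, 'v::ab_group_add) zalg \<Rightarrow> ('g, 'k, 'g \<Rightarrow> 'v) zalg" where
  "E_alg G H \<alpha> B =
    \<lparr> zscale = (\<lambda>c a x. zscale B c (a x)),
      zcomp = E_comp G H \<alpha> B,
      zact = E_act G \<alpha> B,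
      zmul = E_mul G H \<alpha> B \<rparr>"

definition L_alg ::
    "('g, 'm) monoid_scheme \<Rightarrow> ('g \<Rightarrow> 'g \<Rightarrow> 'g \<Rightarrow> 'k::field) \<Rightarrow> 'g set \<Rightarrow>
      ('g \<Rightarrow> 'g \<Rightarrow> 'k) \<Rightarrow> ('g, 'k, 'g \<Rightarrow> 'g \<Rightarrow> 'k) zalg" where
  "L_alg G \<alpha> H \<gamma> = E_alg G H \<alpha> (tw_group_alg (G\<lparr>carrier := H\<rparr>) \<gamma>)"


section \<open>Well-definedness\<close>

lemma (in vector_space) trace_on_eq:
  assumes indep: "independent B" and fin: "finite B"
    and T: "\<And>v. v \<in> span B \<Longrightarrow> T v \<in> span B"
    and add: "\<And>v w. v \<in> span B \<Longrightarrow> w \<in> span B \<Longrightarrow> T (v + w) = T v + T w"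
    and scale: "\<And>c v. v \<in> span B \<Longrightarrow> T (scale c v) = scale c (T v)"
  shows "trace_on scale (span B) T = (\<Sum>b\<in>B. representation B (T b) b)"
proof -
  define C where "C = (SOME C. independent C \<and> span C = span B)"
  have "\<exists>C. independent C \<and> span C = span B"
    using indep by blast
  then have C: "independent C \<and> span C = span B"
    unfolding C_def by (rule someI_ex)
  have "C \<subseteq> span B"
    using C span_superset by blast
  then have finC: "finite C"
    using C fin independent_span_bound by blast
  have T0: "T 0 = 0"
    using scale[of 0 0] span_zero by simp
  have Tsum: "T (\<Sum>i\<in>I. scale (c i) (u i)) = (\<Sum>i\<in>I. scale (c i) (T (u i)))"
    if "finite I" "\<And>i. i \<in> I \<Longrightarrow> u i \<in> span B" for I c and u :: "'b \<Rightarrow> 'b"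
    using that
  proof (induction I rule: finite_induct)
    case empty
    show ?case by (simp add: T0)
  next
    case (insert i I)
    then have "scale (c i) (u i) \<in> span B" "(\<Sum>i\<in>I. scale (c i) (u i)) \<in> span B"
      by (auto intro: span_scale span_sum)
    then show ?case
      using insert by (simp add: add scale)
  qed
  have rep: "representation D (T v) d = (\<Sum>e\<in>F. representation F v e * representation D (T e) d)"
    if "independent D" "span D = span B" "independent F" "span F = span B" "finite F"
      "v \<in> span B" for D F v d
  proof -
    have FB: "F \<subseteq> span B"
      using that span_superset by blast
    have "v = (\<Sum>e\<in>F. scale (representation F v e) e)"
      using that by (subst sum_representation_eq) auto
    then have "T v = (\<Sum>e\<in>F. scale (representation F v e) (T e))"
      using Tsum[of F "\<lambda>e. e" "representation F v"] that FB by auto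
    then have "representation D (T v) d =
        representation D (\<Sum>e\<in>F. scale (representation F v e) (T e)) d"
      by simp
    also have "\<dots> = (\<Sum>e\<in>F. representation F v e * representation D (T e) d)"
      using that FB T by (subst representation_sum)
        (auto simp: representation_scale intro!: span_scale sum.cong)
    finally show ?thesis .
  qed
  have expand: "representation D w d = (\<Sum>e\<in>F. representation F w e * representation D e d)"
    if "independent D" "span D = span B" "independent F" "span F = span B" "finite F"
      "w \<in> span B" for D F w d
  proof -
    have FB: "F \<subseteq> span D"
      using that span_superset by blast
    have "w = (\<Sum>e\<in>F. scale (representation F w e) e)"
      using that by (subst sum_representation_eq) auto
    then have "representation D w d =
        representation D (\<Sum>e\<in>F. scale (representation F w e) e) d"
      by simp
    also have "\<dots> = (\<Sum>e\<in>F. representation F w e * representation D e d)"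
      using that FB by (subst representation_sum)
        (auto simp: representation_scale intro!: span_scale sum.cong)
    finally show ?thesis .
  qed
  have CB: "c \<in> span B" if "c \<in> C" for c
    using that \<open>C \<subseteq> span B\<close> by blast
  have BB: "b \<in> span B" if "b \<in> B" for b
    using that by (rule span_base)
  have "(\<Sum>c\<in>C. representation C (T c) c) =
      (\<Sum>c\<in>C. \<Sum>b\<in>B. representation B c b * representation C (T b) c)"
    using C indep fin CB by (intro sum.cong refl rep) auto
  also have "\<dots> = (\<Sum>b\<in>B. \<Sum>c\<in>C. representation C (T b) c * representation B c b)"
    by (subst sum.swap) (simp add: mult.commute)
  also have "\<dots> = (\<Sum>b\<in>B. representation B (T b) b)"
    using C indep fin finC BB T by (intro sum.cong refl expand[symmetric]) auto
  finally show ?thesis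
    by (simp add: trace_on_def C_def[symmetric] Let_def)
qed


lemma vector_space_fun:
  assumes "vector_space s"
  shows "vector_space (\<lambda>c (a :: 'x \<Rightarrow> 'v::ab_group_add) x. s (c :: 'k::field) (a x))"
proof -
  interpret vector_space s by fact
  show ?thesis
    by unfold_locales (auto simp: fun_eq_iff scale_right_distrib scale_left_distrib)
qed

context group
begin

lemma conj_by_closed [simp]:
  "x \<in> carrier G \<Longrightarrow> h \<in> carrier G \<Longrightarrow> conj_by G x h \<in> carrier G"
  by (simp add: conj_by_def)

lemma conj_by_one [simp]: "h \<in> carrier G \<Longrightarrow> conj_by G \<one> h = h"
  by (simp add: conj_by_def)

lemma conj_by_mult:
  "x \<in> carrier G \<Longrightarrow> y \<in> carrier G \<Longrightarrow> h \<in> carrier G \<Longrightarrow>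
    conj_by G (x \<otimes> y) h = conj_by G x (conj_by G y h)"
  by (simp add: conj_by_def inv_mult_group m_assoc)

lemma conj_by_swap:
  "x \<in> carrier G \<Longrightarrow> h \<in> carrier G \<Longrightarrow> conj_by G x h \<otimes> x = x \<otimes> h"
  by (simp add: conj_by_def m_assoc)

lemma coc_act_nonzero:
  assumes "normalised_3cocycle G \<alpha>" "p \<in> carrier G" "q \<in> carrier G" "h \<in> carrier G"
  shows "coc_act G \<alpha> p q h \<noteq> 0"
  using assms by (simp add: coc_act_def normalised_3cocycle_def)

lemma coc_act_one:
  assumes "normalised_3cocycle G \<alpha>" "p \<in> carrier G" "h \<in> carrier G"
  shows "coc_act G \<alpha> p \<one> h = 1" "coc_act G \<alpha> \<one> p h = 1"
proof -
  have "\<alpha> u v w = 1" if "u = \<one> \<or> v = \<one> \<or> w = \<one>"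
    "u \<in> carrier G" "v \<in> carrier G" "w \<in> carrier G" for u v w
    using assms(1) that unfolding normalised_3cocycle_def by blast
  then show "coc_act G \<alpha> p \<one> h = 1" "coc_act G \<alpha> \<one> p h = 1"
    using assms(2,3) by (simp_all add: coc_act_def)
qed

lemma coc_act_cocycle:
  assumes \<alpha>: "normalised_3cocycle G \<alpha>"
    and [simp]: "p \<in> carrier G" "q \<in> carrier G" "r \<in> carrier G" "h \<in> carrier G"
  shows "coc_act G \<alpha> p q (conj_by G r h) * coc_act G \<alpha> (p \<otimes> q) r h =
    coc_act G \<alpha> p (q \<otimes> r) h * coc_act G \<alpha> q r h"
proof -
  define h1 where "h1 = conj_by G r h"
  define h2 where "h2 = conj_by G q h1"
  define h3 where "h3 = conj_by G p h2"
  have [simp]: "h1 \<in> carrier G" "h2 \<in> carrier G" "h3 \<in> carrier G"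
    by (simp_all add: h1_def h2_def h3_def)
  have sw: "h1 \<otimes> r = r \<otimes> h" "h2 \<otimes> q = q \<otimes> h1" "h3 \<otimes> p = p \<otimes> h2"
    by (simp_all add: h1_def h2_def h3_def conj_by_swap)
  have cj: "conj_by G (p \<otimes> q) h1 = h3" "conj_by G (p \<otimes> q \<otimes> r) h = h3"
    "conj_by G (p \<otimes> (q \<otimes> r)) h = h3" "conj_by G (q \<otimes> r) h = h2"
    by (simp_all add: h1_def h2_def h3_def conj_by_mult)
  have nz: "\<alpha> a b c \<noteq> 0" if "a \<in> carrier G" "b \<in> carrier G" "c \<in> carrier G" for a b c
    using \<alpha> that by (simp add: normalised_3cocycle_def)
  have coc: "\<alpha> b c d * \<alpha> a (b \<otimes> c) d * \<alpha> a b c = \<alpha> (a \<otimes> b) c d * \<alpha> a b (c \<otimes> d)"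
    if "a \<in> carrier G" "b \<in> carrier G" "c \<in> carrier G" "d \<in> carrier G" for a b c d
    using \<alpha> that by (simp add: normalised_3cocycle_def)
  have e1: "\<alpha> q r h * \<alpha> p (q \<otimes> r) h * \<alpha> p q r = \<alpha> (p \<otimes> q) r h * \<alpha> p q (r \<otimes> h)"
    by (rule coc) simp_all
  have e2: "\<alpha> q h1 r * \<alpha> p (q \<otimes> h1) r * \<alpha> p q h1 = \<alpha> (p \<otimes> q) h1 r * \<alpha> p q (r \<otimes> h)"
    using coc[of p q h1 r] sw by simp
  have e3: "\<alpha> h2 q r * \<alpha> p (q \<otimes> h1) r * \<alpha> p h2 q = \<alpha> (p \<otimes> h2) q r * \<alpha> p h2 (q \<otimes> r)"
    using coc[of p h2 q r] sw by simp
  have e4: "\<alpha> p q r * \<alpha> h3 (p \<otimes> q) r * \<alpha> h3 p q = \<alpha> (p \<otimes> h2) q r * \<alpha> h3 p (q \<otimes> r)"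
    using coc[of h3 p q r] sw by simp
  have s1: "\<alpha> (p \<otimes> q) r h = \<alpha> q r h * \<alpha> p (q \<otimes> r) h * \<alpha> p q r / \<alpha> p q (r \<otimes> h)"
    using e1 nz by (simp add: field_simps)
  have s2: "\<alpha> (p \<otimes> q) h1 r = \<alpha> q h1 r * \<alpha> p (q \<otimes> h1) r * \<alpha> p q h1 / \<alpha> p q (r \<otimes> h)"
    using e2 nz by (simp add: field_simps)
  have s3: "\<alpha> p h2 (q \<otimes> r) = \<alpha> h2 q r * \<alpha> p (q \<otimes> h1) r * \<alpha> p h2 q / \<alpha> (p \<otimes> h2) q r"
    using e3 nz by (simp add: field_simps)
  have s4: "\<alpha> h3 p (q \<otimes> r) = \<alpha> p q r * \<alpha> h3 (p \<otimes> q) r * \<alpha> h3 p q / \<alpha> (p \<otimes> h2) q r"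
    using e4 nz by (simp add: field_simps)
  show ?thesis
    unfolding coc_act_def h1_def[symmetric] h2_def[symmetric] h3_def[symmetric] cj s1 s2 s3 s4
    using nz by (simp add: field_simps)
qed

lemma z_object_tw_group_alg:
  fixes \<gamma> :: "'a \<Rightarrow> 'a \<Rightarrow> 'k::field"
  assumes \<gamma>: "normalised_2cochain G \<gamma>"
    and d: "\<And>u v w. u \<in> carrier G \<Longrightarrow> v \<in> carrier G \<Longrightarrow> w \<in> carrier G \<Longrightarrow>
      coboundary2 G \<gamma> u v w = \<alpha> u v w"
  shows "z_object G \<alpha> (tw_group_alg G \<gamma>)"
proof -
  let ?s = "\<lambda>(c::'k) (v::'a \<Rightarrow> 'k) x. c * v x"
  have "vector_space ((*) :: 'k \<Rightarrow> 'k \<Rightarrow> 'k)"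
    by unfold_locales (auto simp: algebra_simps)
  from vector_space_fun[OF this] interpret V: vector_space ?s .
  have nz: "\<gamma> a b \<noteq> 0" if "a \<in> carrier G" "b \<in> carrier G" for a b
    using \<gamma> that by (simp add: normalised_2cochain_def)
  have comp: "{v. \<exists>c. v = (\<lambda>x. c * tw_basis f x)} = V.span {tw_basis f}" for f
    by (auto simp: V.span_singleton)
  have coef: "\<gamma> (p \<otimes> q) h / \<gamma> (conj_by G (p \<otimes> q) h) (p \<otimes> q) =
      coc_act G \<alpha> p q h * (\<gamma> q h / \<gamma> (conj_by G q h) q *
        (\<gamma> p (conj_by G q h) / \<gamma> (conj_by G p (conj_by G q h)) p))"
    if [simp]: "p \<in> carrier G" "q \<in> carrier G" "h \<in> carrier G" for p q h
  proof -
    define h1 where "h1 = conj_by G q h"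
    define h2 where "h2 = conj_by G p h1"
    have [simp]: "h1 \<in> carrier G" "h2 \<in> carrier G"
      by (simp_all add: h1_def h2_def)
    have sw: "h1 \<otimes> q = q \<otimes> h" "h2 \<otimes> p = p \<otimes> h1"
      by (simp_all add: h1_def h2_def conj_by_swap)
    have cj: "conj_by G (p \<otimes> q) h = h2"
      by (simp add: h1_def h2_def conj_by_mult)
    show ?thesis
      unfolding coc_act_def cj h1_def[symmetric] h2_def[symmetric]
      using nz by (simp add: d[symmetric] coboundary2_def sw field_simps)
  qed
  have bij: "bij_betw (\<lambda>v x. v h * (\<gamma> p h / \<gamma> (conj_by G p h) p) * tw_basis (conj_by G p h) x)
      {v. \<exists>c. v = (\<lambda>x. c * tw_basis h x)}
      {v. \<exists>c. v = (\<lambda>x. c * tw_basis (conj_by G p h) x)}"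
    if [simp]: "p \<in> carrier G" "h \<in> carrier G" for p h
    using nz[of p h] nz[of "conj_by G p h" p]
    by (intro bij_betw_byWitness[where f' = "\<lambda>v x.
          v (conj_by G p h) / (\<gamma> p h / \<gamma> (conj_by G p h) p) * tw_basis h x"])
      (auto simp: tw_basis_def fun_eq_iff)
  show ?thesis
    unfolding z_object_def
  proof (intro conjI ballI)
    fix p q h v
    assume *: "p \<in> carrier G" "q \<in> carrier G" "h \<in> carrier G"
      "v \<in> zcomp (tw_group_alg G \<gamma>) h"
    show "zact (tw_group_alg G \<gamma>) (p \<otimes> q) h v =
      zscale (tw_group_alg G \<gamma>) (coc_act G \<alpha> p q h)
        (zact (tw_group_alg G \<gamma>) p (conj_by G q h) (zact (tw_group_alg G \<gamma>) q h v))"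
    proof
      fix x
      have "v h * (\<gamma> (p \<otimes> q) h / \<gamma> (conj_by G (p \<otimes> q) h) (p \<otimes> q)) *
          tw_basis (conj_by G (p \<otimes> q) h) x =
        coc_act G \<alpha> p q h * (v h * (\<gamma> q h / \<gamma> (conj_by G q h) q) *
          (\<gamma> p (conj_by G q h) / \<gamma> (conj_by G p (conj_by G q h)) p) *
          tw_basis (conj_by G p (conj_by G q h)) x)"
        unfolding coef[OF *(1-3)] using * by (simp add: conj_by_mult)
      then show "zact (tw_group_alg G \<gamma>) (p \<otimes> q) h v x =
        zscale (tw_group_alg G \<gamma>) (coc_act G \<alpha> p q h)
          (zact (tw_group_alg G \<gamma>) p (conj_by G q h) (zact (tw_group_alg G \<gamma>) q h v)) x"
        by (simp add: tw_group_alg_def) (simp add: tw_basis_def)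
    qed
  next
    show "vector_space (zscale (tw_group_alg G \<gamma>))"
      using V.vector_space_axioms by (simp add: tw_group_alg_def)
  next
    fix h
    show "module.subspace (zscale (tw_group_alg G \<gamma>)) (zcomp (tw_group_alg G \<gamma>) h)"
      using V.subspace_span by (simp add: tw_group_alg_def comp)
    show "\<exists>B. finite B \<and> zcomp (tw_group_alg G \<gamma>) h \<subseteq>
        module.span (zscale (tw_group_alg G \<gamma>)) B"
      by (rule exI[of _ "{tw_basis h}"]) (simp add: tw_group_alg_def comp)
  next
    fix p h assume "p \<in> carrier G" "h \<in> carrier G"
    then show "bij_betw (zact (tw_group_alg G \<gamma>) p h) (zcomp (tw_group_alg G \<gamma>) h)
        (zcomp (tw_group_alg G \<gamma>) (conj_by G p h))"
      using bij by (simp add: tw_group_alg_def)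
  next
    fix p h v w
    show "zact (tw_group_alg G \<gamma>) p h (v + w) =
        zact (tw_group_alg G \<gamma>) p h v + zact (tw_group_alg G \<gamma>) p h w"
      by (rule ext) (simp add: tw_group_alg_def distrib_right add_divide_distrib)
  next
    fix p h
    have "zact (tw_group_alg G \<gamma>) p h (zscale (tw_group_alg G \<gamma>) c v) =
        zscale (tw_group_alg G \<gamma>) c (zact (tw_group_alg G \<gamma>) p h v)" for c v
      by (rule ext) (simp add: tw_group_alg_def)
    then show "\<forall>c. \<forall>v\<in>zcomp (tw_group_alg G \<gamma>) h. zact (tw_group_alg G \<gamma>) p h
        (zscale (tw_group_alg G \<gamma>) c v) =
        zscale (tw_group_alg G \<gamma>) c (zact (tw_group_alg G \<gamma>) p h v)"
      by blast
  qed
qed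

lemma conj_by_subgroup:
  assumes "subgroup H G" "x \<in> H"
  shows "conj_by (G\<lparr>carrier := H\<rparr>) x h = conj_by G x h"
  using assms by (simp add: conj_by_def m_inv_consistent)

lemma z_object_E_alg:
  fixes B :: "('a, 'k::field, 'v::ab_group_add) zalg"
  assumes fin: "finite (carrier G)" and \<alpha>: "normalised_3cocycle G \<alpha>" and H: "subgroup H G"
    and B: "z_object (G\<lparr>carrier := H\<rparr>) \<alpha> B"
  shows "z_object G \<alpha> (E_alg G H \<alpha> B)"
proof -
  let ?s = "zscale B"
  let ?c = "coc_act G \<alpha>"
  let ?X = "E_alg G H \<alpha> B"
  interpret V: vector_space ?s
    using B by (simp add: z_object_def)
  interpret F: vector_space "\<lambda>c (a :: 'a \<Rightarrow> 'v) x. ?s c (a x)"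
    by (rule vector_space_fun) (rule V.vector_space_axioms)
  have HG: "u \<in> carrier G" if "u \<in> H" for u
    using subgroup.mem_carrier[OF H that] .
  have Hinv: "inv u \<in> H" if "u \<in> H" for u
    using subgroup.m_inv_closed[OF H that] .
  have cj: "conj_by (G\<lparr>carrier := H\<rparr>) x h = conj_by G x h" if "x \<in> H" for x h
    using conj_by_subgroup[OF H that] .
  have cjH: "conj_by G x h \<in> H" if "x \<in> H" "h \<in> H" for x h
    using that H unfolding conj_by_def by (meson Hinv subgroup.m_closed)
  have sub: "V.subspace (zext_comp H B h)" for h
    using B by (auto simp: zext_comp_def z_object_def V.subspace_single_0)
  have fdim: "\<exists>A. finite A \<and> zext_comp H B h \<subseteq> V.span A" for h
    using B by (auto simp: zext_comp_def z_object_def V.span_zero)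
  have act_add: "zext_act H B u h (v + w) = zext_act H B u h v + zext_act H B u h w"
    if "u \<in> H" "v \<in> zext_comp H B h" "w \<in> zext_comp H B h" for u h v w
    using B that by (auto simp: zext_act_def zext_comp_def z_object_def)
  have act_scale: "zext_act H B u h (?s c v) = ?s c (zext_act H B u h v)"
    if "u \<in> H" "v \<in> zext_comp H B h" for u h c v
    using B that by (auto simp: zext_act_def zext_comp_def z_object_def)
  have act_zero: "zext_act H B u h 0 = 0" if "u \<in> H" for u h
    using act_scale[of u 0 h 0] V.subspace_0[OF sub[of h]] that by simp
  have cnz: "?c p q h \<noteq> 0" if "p \<in> carrier G" "q \<in> carrier G" "h \<in> carrier G" for p q h
    using coc_act_nonzero[OF \<alpha> that] .

  have Esub: "F.subspace (E_comp G H \<alpha> B h)" if "h \<in> carrier G" for h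
    unfolding F.subspace_def E_comp_def
    by (auto simp: act_zero act_add act_scale Hinv V.scale_right_distrib mult.commute
        V.subspace_0[OF sub] V.subspace_add[OF sub] V.subspace_scale[OF sub])

  have Efin: "\<exists>A. finite A \<and> E_comp G H \<alpha> B h \<subseteq> F.span A" for h
  proof -
    have "\<forall>x. \<exists>A. finite A \<and> zext_comp H B (conj_by G (inv x) h) \<subseteq> V.span A"
      using fdim by blast
    from choice[OF this] obtain A where A: "\<And>x. finite (A x)"
      "\<And>x. zext_comp H B (conj_by G (inv x) h) \<subseteq> V.span (A x)"
      by blast
    define \<delta> where "\<delta> = (\<lambda>(x::'a) (v::'v) y. if y = x then v else 0)"
    have lin: "\<delta> x v \<in> F.span (\<delta> x ` S)" if "v \<in> V.span S" for x v S
      using that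
    proof (induction rule: V.span_induct_alt)
      case base
      have "\<delta> x 0 = 0" by (simp add: \<delta>_def fun_eq_iff)
      moreover have "0 \<in> F.span (\<delta> x ` S)" by (rule F.span_zero)
      ultimately show ?case by (simp only:)
    next
      case (step c w u)
      have "\<delta> x (?s c w + u) = (\<lambda>y. ?s c (\<delta> x w y)) + \<delta> x u"
        by (simp add: \<delta>_def fun_eq_iff)
      then show ?case
        using step by (metis F.span_add F.span_base F.span_scale imageI)
    qed
    let ?A = "\<Union>x\<in>carrier G. \<delta> x ` A x"
    have "a \<in> F.span ?A" if a: "a \<in> E_comp G H \<alpha> B h" for a
    proof -
      have app: "(\<Sum>x\<in>S. \<delta> x (a x)) y = (if y \<in> S then a y else 0)" if "finite S" for S y
        using that by (induction S rule: finite_induct) (auto simp: \<delta>_def)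
      have "a = (\<Sum>x\<in>carrier G. \<delta> x (a x))"
        using a by (auto simp: app[OF fin] E_comp_def fun_eq_iff)
      also have "\<dots> \<in> F.span ?A"
      proof (rule F.span_sum)
        fix x assume x: "x \<in> carrier G"
        have "a x \<in> V.span (A x)"
          using a A(2)[of x] x unfolding E_comp_def by blast
        then have "\<delta> x (a x) \<in> F.span (\<delta> x ` A x)" by (rule lin)
        also have "\<dots> \<subseteq> F.span ?A"
          using x by (intro F.span_mono) auto
        finally show "\<delta> x (a x) \<in> F.span ?A" .
      qed
      finally show ?thesis .
    qed
    then show ?thesis
      using A fin by (intro exI[of _ ?A]) auto
  qed

  have Eact: "E_act G \<alpha> B g h a \<in> E_comp G H \<alpha> B (conj_by G g h)"
    if [simp]: "g \<in> carrier G" "h \<in> carrier G" and a: "a \<in> E_comp G H \<alpha> B h" for g h a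
  proof -
    have cg: "conj_by G (inv (inv g \<otimes> x)) h = conj_by G (inv x) (conj_by G g h)"
      if "x \<in> carrier G" for x
      using that by (simp add: inv_mult_group conj_by_mult)
    have mem: "a (inv g \<otimes> x) \<in> zext_comp H B (conj_by G (inv x) (conj_by G g h))"
      if [simp]: "x \<in> carrier G" for x
    proof -
      have "a (inv g \<otimes> x) \<in> zext_comp H B (conj_by G (inv (inv g \<otimes> x)) h)"
        using a by (simp add: E_comp_def)
      then show ?thesis by (simp only: cg[OF that])
    qed
    have eqv: "E_act G \<alpha> B g h a (x \<otimes> u) =
        ?s (?c (inv u) (inv x) (conj_by G g h))
          (zext_act H B (inv u) (conj_by G (inv x) (conj_by G g h)) (E_act G \<alpha> B g h a x))"
      if x[simp]: "x \<in> carrier G" and u: "u \<in> H" for x u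
    proof -
      have uG[simp]: "u \<in> carrier G" using HG u .
      let ?z = "zext_act H B (inv u) (conj_by G (inv x) (conj_by G g h)) (a (inv g \<otimes> x))"
      have "a (inv g \<otimes> x \<otimes> u) = ?s (?c (inv u) (inv (inv g \<otimes> x)) h)
          (zext_act H B (inv u) (conj_by G (inv (inv g \<otimes> x)) h) (a (inv g \<otimes> x)))"
        using a u by (simp add: E_comp_def)
      then have "a (inv g \<otimes> (x \<otimes> u)) = ?s (?c (inv u) (inv x \<otimes> g) h) ?z"
        by (simp only: cg[OF x]) (simp add: inv_mult_group m_assoc)
      then have l: "E_act G \<alpha> B g h a (x \<otimes> u) =
          ?s (inverse (?c (inv u \<otimes> inv x) g h) * ?c (inv u) (inv x \<otimes> g) h) ?z"
        by (simp add: E_act_def inv_mult_group)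
      have r: "?s (?c (inv u) (inv x) (conj_by G g h))
          (zext_act H B (inv u) (conj_by G (inv x) (conj_by G g h)) (E_act G \<alpha> B g h a x)) =
          ?s (?c (inv u) (inv x) (conj_by G g h) * inverse (?c (inv x) g h)) ?z"
        using mem[OF x] by (simp add: E_act_def act_scale Hinv u)
      have "inverse (?c (inv u \<otimes> inv x) g h) * ?c (inv u) (inv x \<otimes> g) h =
          ?c (inv u) (inv x) (conj_by G g h) * inverse (?c (inv x) g h)"
        using coc_act_cocycle[OF \<alpha>, of "inv u" "inv x" g h]
          cnz[of "inv u \<otimes> inv x" g h] cnz[of "inv x" g h]
        by (simp add: field_simps)
      then show ?thesis by (simp only: l r)
    qed
    show ?thesis
      using mem eqv V.subspace_scale[OF sub]
      unfolding E_comp_def by (auto simp: E_act_def)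
  qed

  have Eproj: "E_act G \<alpha> B (p \<otimes> q) h a =
      (\<lambda>x. ?s (?c p q h) (E_act G \<alpha> B p (conj_by G q h) (E_act G \<alpha> B q h a) x))"
    if [simp]: "p \<in> carrier G" "q \<in> carrier G" "h \<in> carrier G" for p q h a
  proof
    fix x
    show "E_act G \<alpha> B (p \<otimes> q) h a x =
      ?s (?c p q h) (E_act G \<alpha> B p (conj_by G q h) (E_act G \<alpha> B q h a) x)"
    proof (cases "x \<in> carrier G")
      case [simp]: True
      have "inverse (?c (inv x) (p \<otimes> q) h) =
          ?c p q h * (inverse (?c (inv x) p (conj_by G q h)) * inverse (?c (inv x \<otimes> p) q h))"
        using coc_act_cocycle[OF \<alpha>, of "inv x" p q h] cnz[of "inv x" p "conj_by G q h"]
          cnz[of "inv x \<otimes> p" q h] cnz[of "inv x" "p \<otimes> q" h] cnz[of p q h]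
        by (simp add: field_simps)
      then show ?thesis
        by (simp add: E_act_def inv_mult_group m_assoc)
    qed (simp add: E_act_def)
  qed

  have Eone: "E_act G \<alpha> B \<one> h a = a" if "h \<in> carrier G" "a \<in> E_comp G H \<alpha> B h" for h a
    using that by (auto simp: E_act_def E_comp_def fun_eq_iff coc_act_one[OF \<alpha>])

  have Eadd: "E_act G \<alpha> B g h (a + b) = E_act G \<alpha> B g h a + E_act G \<alpha> B g h b" for g h a b
    by (auto simp: E_act_def fun_eq_iff V.scale_right_distrib)
  have Escale: "E_act G \<alpha> B g h (\<lambda>x. ?s c (a x)) = (\<lambda>x. ?s c (E_act G \<alpha> B g h a x))"
    for g h c a
    by (auto simp: E_act_def fun_eq_iff mult.commute)

  have Ebij: "bij_betw (E_act G \<alpha> B g h) (E_comp G H \<alpha> B h) (E_comp G H \<alpha> B (conj_by G g h))"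
    if [simp]: "g \<in> carrier G" "h \<in> carrier G" for g h
  proof -
    have cjback: "conj_by G (inv g) (conj_by G g h) = h"
      by (simp add: conj_by_mult[symmetric])
    let ?back = "\<lambda>b x. ?s (?c (inv g) g h) (E_act G \<alpha> B (inv g) (conj_by G g h) b x)"
    have left: "?back (E_act G \<alpha> B g h a) = a" if "a \<in> E_comp G H \<alpha> B h" for a
      using Eproj[of "inv g" g h a] Eone[of h a] that by simp
    have invmem: "?back b \<in> E_comp G H \<alpha> B h" if "b \<in> E_comp G H \<alpha> B (conj_by G g h)" for b
      using Eact[of "inv g" "conj_by G g h" b] that F.subspace_scale[OF Esub[of h]]
      by (simp add: cjback)
    have injz: "b = 0" if b: "b \<in> E_comp G H \<alpha> B (conj_by G g h)" and "?back b = 0" for b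
    proof
      fix y
      show "b y = 0 y"
      proof (cases "y \<in> carrier G")
        case [simp]: True
        have "?back b (inv g \<otimes> y) = 0" using that(2) by (auto simp: fun_eq_iff)
        then show ?thesis
          using cnz[of "inv g" g h] cnz[of "inv (inv g \<otimes> y)" "inv g" "conj_by G g h"]
          by (simp add: E_act_def m_assoc[symmetric])
      next
        case False
        then show ?thesis using b by (simp add: E_comp_def)
      qed
    qed
    have right: "E_act G \<alpha> B g h (?back b) = b" if b: "b \<in> E_comp G H \<alpha> B (conj_by G g h)" for b
    proof -
      let ?b = "E_act G \<alpha> B g h (?back b)"
      have mem: "?b \<in> E_comp G H \<alpha> B (conj_by G g h)"
        using Eact invmem b by simp
      have "?back (?b - b) + ?back b = ?back ((?b - b) + b)"
        unfolding Eadd by (simp add: fun_eq_iff V.scale_right_distrib)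
      also have "\<dots> = ?back b"
        using left[OF invmem[OF b]] by simp
      finally have "?back (?b - b) = 0" by simp
      moreover have "?b - b \<in> E_comp G H \<alpha> B (conj_by G g h)"
        using F.subspace_diff[OF Esub mem b] by simp
      ultimately show ?thesis
        using injz by fastforce
    qed
    show ?thesis
      by (rule bij_betw_byWitness[where f' = ?back]) (use left right Eact invmem in auto)
  qed
  show ?thesis
    unfolding z_object_def
    using F.vector_space_axioms Esub Efin Ebij Eproj Eadd Escale
    by (auto simp: E_alg_def)
qed

theorem z_object_L_alg:
  assumes "finite (carrier G)" "normalised_3cocycle G \<alpha>" "subgroup H G"
    and "normalised_2cochain (G\<lparr>carrier := H\<rparr>) \<gamma>"
    and "\<And>u v w. u \<in> H \<Longrightarrow> v \<in> H \<Longrightarrow> w \<in> H \<Longrightarrow>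
      coboundary2 (G\<lparr>carrier := H\<rparr>) \<gamma> u v w = \<alpha> u v w"
  shows "z_object G \<alpha> (L_alg G \<alpha> H \<gamma>)"
proof -
  interpret K: group "G\<lparr>carrier := H\<rparr>"
    using assms(3) by (rule subgroup_imp_group)
  show ?thesis
    unfolding L_alg_def using assms
    by (intro z_object_E_alg K.z_object_tw_group_alg) auto
qed

end

end

theory Submission
  imports Defs
begin

text \<open>An element of \<open>L\<^sub>f\<close> is determined by its values on representatives \<open>r\<close> of the cosets in
  \<open>{x. x\<^sup>-\<^sup>1 f x \<in> H}/H\<close>, and each value lies on the line spanned by \<open>e\<^sub>u\<close>, \<open>u = r\<^sup>-\<^sup>1 f r\<close>. Hence
  \<open>L\<^sub>f\<close> has a basis indexed by such \<open>r\<close>, which \<open>g\<close> permutes up to scalars; only the cosets with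
  \<open>g r H = r H\<close>, that is \<open>r\<^sup>-\<^sup>1 g r \<in> H\<close>, contribute to the trace. Choosing the representatives to
  extend \<open>Y\<close>, the diagonal entry at \<open>r\<close> is found by evaluating the \<open>r\<close>-th basis element at
  \<open>g\<^sup>-\<^sup>1 r = r (r\<^sup>-\<^sup>1 g r)\<^sup>-\<^sup>1\<close>.\<close>

section \<open>Traces computed from a dual basis\<close>

text \<open>Duality makes the vectors \<open>b r\<close> independent and makes
  \<open>\<phi> t\<close> the \<open>t\<close>-th coordinate on \<open>S\<close>, so the summands
  are the diagonal entries of the matrix of \<open>T\<close>. No \<open>representation\<close> has
  to be computed when the lemma is applied.\<close>

lemma (in vector_space) trace_on_dual_basis:
  assumes R: "finite R" and S: "subspace S"
    and b: "\<And>r. r \<in> R \<Longrightarrow> b r \<in> S"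
    and \<phi>: "\<And>r. r \<in> R \<Longrightarrow> Vector_Spaces.linear scale (*) (\<phi> r)"
    and dual: "\<And>r t. r \<in> R \<Longrightarrow> t \<in> R \<Longrightarrow> \<phi> t (b r) = (if r = t then 1 else 0)"
    and expand: "\<And>v. v \<in> S \<Longrightarrow> v = (\<Sum>r\<in>R. scale (\<phi> r v) (b r))"
    and T: "\<And>v. v \<in> S \<Longrightarrow> T v \<in> S"
    and add: "\<And>v w. v \<in> S \<Longrightarrow> w \<in> S \<Longrightarrow> T (v + w) = T v + T w"
    and scale: "\<And>c v. v \<in> S \<Longrightarrow> T (scale c v) = scale c (T v)"
  shows "trace_on scale S T = (\<Sum>r\<in>R. \<phi> r (T (b r)))"
proof -
  have \<phi>_sum: "\<phi> t (\<Sum>r\<in>R. scale (c r) (b r)) = c t" if t: "t \<in> R" for c t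
  proof -
    interpret p: Vector_Spaces.linear scale "(*)" "\<phi> t" using \<phi>[OF t] .
    show ?thesis
      using R t by (simp add: p.sum p.scale dual if_distrib[where f = "\<lambda>x. _ * x"]
          cong: if_cong)
  qed
  have inj: "inj_on b R"
    using dual by (intro inj_onI) (metis zero_neq_one)
  have indep: "independent (b ` R)"
  proof (rule independent_if_scalars_zero)
    fix c v assume "(\<Sum>v\<in>b ` R. scale (c v) v) = 0" and "v \<in> b ` R"
    then obtain t where t: "t \<in> R" "v = b t" and "(\<Sum>r\<in>R. scale (c (b r)) (b r)) = 0"
      by (auto simp: sum.reindex[OF inj])
    then have "c (b t) = \<phi> t 0"
      using \<phi>_sum[of t "\<lambda>r. c (b r)"] by simp
    also have "\<dots> = \<phi> t (\<Sum>r\<in>R. scale 0 (b r))"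
      by simp
    also have "\<dots> = 0"
      using t(1) by (rule \<phi>_sum)
    finally show "c v = 0"
      using t by simp
  qed (use R in simp)
  have span: "span (b ` R) = S"
  proof
    show "span (b ` R) \<subseteq> S"
      using b by (intro span_minimal S) auto
    show "S \<subseteq> span (b ` R)"
    proof
      fix v assume "v \<in> S"
      then have "v = (\<Sum>r\<in>R. scale (\<phi> r v) (b r))" by (rule expand)
      also have "\<dots> \<in> span (b ` R)"
        by (intro span_sum span_scale span_base) auto
      finally show "v \<in> span (b ` R)" .
    qed
  qed
  have rep: "representation (b ` R) v (b t) = \<phi> t v" if "v \<in> S" "t \<in> R" for v t
  proof -
    have "representation (b ` R) v (b t) =
        representation (b ` R) (\<Sum>r\<in>R. scale (\<phi> r v) (b r)) (b t)"
      using expand[OF that(1)] by simp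
    also have "\<dots> = (\<Sum>r\<in>R. \<phi> r v * representation (b ` R) (b r) (b t))"
      using indep by (subst representation_sum)
        (auto simp: representation_scale span_base intro!: span_scale sum.cong)
    also have "\<dots> = (\<Sum>r\<in>R. if r = t then \<phi> r v else 0)"
      using indep that(2) inj
      by (intro sum.cong) (auto simp: representation_basis inj_on_eq_iff)
    also have "\<dots> = \<phi> t v"
      using R that(2) by simp
    finally show ?thesis .
  qed
  have "trace_on scale S T = (\<Sum>v\<in>b ` R. representation (b ` R) (T v) v)"
    unfolding span[symmetric] using indep R T add scale
    by (intro trace_on_eq) (simp_all add: span)
  also have "\<dots> = (\<Sum>r\<in>R. \<phi> r (T (b r)))"
    by (simp add: sum.reindex[OF inj] rep T b)
  finally show ?thesis .
qed

section \<open>Restriction to \<open>H\<close> and elements of \<open>E(V)\<close> supported on one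
  coset\<close>

text \<open>Since \<alpha>(e,e|h) = 1, projectivity makes the action of the identity idempotent, and
  an injective idempotent map is the identity.\<close>

lemma (in group) z_object_act_one:
  assumes \<alpha>: "normalised_3cocycle G \<alpha>" and X: "z_object G \<alpha> X"
    and h: "h \<in> carrier G" and v: "v \<in> zcomp X h"
  shows "zact X \<one> h v = v"
proof -
  interpret vector_space "zscale X" using X by (simp add: z_object_def)
  have "bij_betw (zact X \<one> h) (zcomp X h) (zcomp X (conj_by G \<one> h))"
    using X h unfolding z_object_def by blast
  then have bij: "bij_betw (zact X \<one> h) (zcomp X h) (zcomp X h)"
    using h by simp
  have "zact X (\<one> \<otimes> \<one>) h v =
      zscale X (coc_act G \<alpha> \<one> \<one> h) (zact X \<one> (conj_by G \<one> h) (zact X \<one> h v))"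
    using X h v unfolding z_object_def by blast
  then have "zact X \<one> h (zact X \<one> h v) = zact X \<one> h v"
    using h by (simp add: coc_act_one[OF \<alpha>])
  then show ?thesis
    using bij v by (metis bij_betw_apply bij_betw_inv_into_left)
qed

lemma normalised_3cocycle_subgroup:
  assumes "normalised_3cocycle G \<alpha>" "subgroup H G"
  shows "normalised_3cocycle (G\<lparr>carrier := H\<rparr>) \<alpha>"
proof -
  have "u \<in> carrier G" if "u \<in> H" for u
    using subgroup.mem_carrier[OF assms(2) that] .
  then show ?thesis
    using assms(1) unfolding normalised_3cocycle_def by (simp del: imp_disjL)
qed

lemma (in group) coc_act_subgroup:
  assumes "subgroup H G" "p \<in> H" "q \<in> H"
  shows "coc_act (G\<lparr>carrier := H\<rparr>) \<alpha> p q h = coc_act G \<alpha> p q h"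
  using assms by (simp add: coc_act_def conj_by_subgroup subgroup.m_closed)

text \<open>The element of \<open>E(V)\<^sub>f\<close> supported on the coset \<open>r H\<close> with value \<open>v\<close> at \<open>r\<close>; a point \<open>x\<close> of
  this coset is \<open>r h\<close> with \<open>h\<^sup>-\<^sup>1 = x\<^sup>-\<^sup>1 r\<close>.\<close>

definition E_ext ::
    "('g, 'm) monoid_scheme \<Rightarrow> 'g set \<Rightarrow> ('g \<Rightarrow> 'g \<Rightarrow> 'g \<Rightarrow> 'k::field) \<Rightarrow>
      ('g, 'k, 'v::ab_group_add, 'z) zobj_scheme \<Rightarrow> 'g \<Rightarrow> 'g \<Rightarrow> 'v \<Rightarrow> 'g \<Rightarrow> 'v" where
  "E_ext G H \<alpha> V f r v =
    (\<lambda>x. if x \<in> carrier G \<and> inv\<^bsub>G\<^esub> x \<otimes>\<^bsub>G\<^esub> r \<in> H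
         then zscale V (coc_act G \<alpha> (inv\<^bsub>G\<^esub> x \<otimes>\<^bsub>G\<^esub> r) (inv\<^bsub>G\<^esub> r) f)
           (zext_act H V (inv\<^bsub>G\<^esub> x \<otimes>\<^bsub>G\<^esub> r) (conj_by G (inv\<^bsub>G\<^esub> r) f) v)
         else 0)"

text \<open>At \<open>x = r\<close> both the scalar and the acting group element become
  trivial.\<close>

lemma (in group) E_ext_self:
  assumes \<alpha>: "normalised_3cocycle G \<alpha>" and H: "subgroup H G"
    and V: "z_object (G\<lparr>carrier := H\<rparr>) \<alpha> V"
    and [simp]: "f \<in> carrier G" "r \<in> carrier G"
    and v: "v \<in> zext_comp H V (conj_by G (inv r) f)"
  shows "E_ext G H \<alpha> V f r v r = v"
proof -
  interpret K: group "G\<lparr>carrier := H\<rparr>" using H by (rule subgroup_imp_group)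
  interpret vector_space "zscale V" using V by (simp add: z_object_def)
  have "zext_act H V \<one> (conj_by G (inv r) f) v = v"
    using K.z_object_act_one[OF normalised_3cocycle_subgroup[OF \<alpha> H] V] v
    by (auto simp: zext_act_def zext_comp_def split: if_splits)
  then show ?thesis
    by (simp add: E_ext_def coc_act_one[OF \<alpha>] subgroup.one_closed[OF H])
qed

text \<open>Equivariance on the coset combines projectivity of the \<open>H\<close>-action on
  \<open>V\<close> with \<open>coc_act_cocycle\<close> for the triple \<open>inv u\<close>,
  \<open>inv x \<otimes> r\<close>, \<open>inv r\<close> in degree \<open>f\<close>.\<close>

lemma (in group) E_ext_closed:
  assumes \<alpha>: "normalised_3cocycle G \<alpha>" and H: "subgroup H G"
    and V: "z_object (G\<lparr>carrier := H\<rparr>) \<alpha> V"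
    and [simp]: "f \<in> carrier G" "r \<in> carrier G"
    and v: "v \<in> zext_comp H V (conj_by G (inv r) f)"
  shows "E_ext G H \<alpha> V f r v \<in> E_comp G H \<alpha> V f"
proof -
  let ?s = "zscale V" and ?c = "coc_act G \<alpha>" and ?K = "G\<lparr>carrier := H\<rparr>"
  interpret V: vector_space ?s using V by (simp add: z_object_def)
  have HG: "u \<in> carrier G" if "u \<in> H" for u
    using subgroup.mem_carrier[OF H that] .
  have Hinv: "inv u \<in> H" if "u \<in> H" for u
    using subgroup.m_inv_closed[OF H that] .
  have Hm: "u \<otimes> w \<in> H" if "u \<in> H" "w \<in> H" for u w
    using subgroup.m_closed[OF H that] .
  \<comment> \<open>Extension by zero branches on whether a degree lies in \<open>H\<close>;
    conjugation by an element of \<open>H\<close> does not change the branch.\<close>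
  have cjH: "conj_by G p h \<in> H \<longleftrightarrow> h \<in> H" if p: "p \<in> H" and h: "h \<in> carrier G" for p h
  proof
    assume *: "conj_by G p h \<in> H"
    have "conj_by G (inv p) (conj_by G p h) = h"
      using HG p h by (simp add: conj_by_mult[symmetric])
    moreover have "conj_by G (inv p) (conj_by G p h) \<in> H"
      unfolding conj_by_def[of _ "inv p"] using * Hm Hinv HG p by simp
    ultimately show "h \<in> H" by simp
  qed (use Hm Hinv p in \<open>simp add: conj_by_def\<close>)
  \<comment> \<open>The next three facts carry closure, homogeneity and projectivity of the
    \<open>H\<close>-action over to the extension of \<open>V\<close> by zero.\<close>
  have act_closed: "zext_act H V p h w \<in> zext_comp H V (conj_by G p h)"
    if p: "p \<in> H" and h: "h \<in> carrier G" and w: "w \<in> zext_comp H V h" for p h w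
  proof (cases "h \<in> H")
    case True
    then have "bij_betw (zact V p h) (zcomp V h) (zcomp V (conj_by ?K p h))"
      using V p by (simp add: z_object_def)
    then show ?thesis
      using True w p h cjH[OF p h] bij_betw_apply
      by (fastforce simp: zext_act_def zext_comp_def conj_by_subgroup[OF H p])
  qed (use cjH[OF p h] in \<open>simp add: zext_act_def zext_comp_def\<close>)
  have act_scale: "zext_act H V p h (?s c w) = ?s c (zext_act H V p h w)"
    if "p \<in> H" "w \<in> zext_comp H V h" for p h c w
    using V that by (auto simp: zext_act_def zext_comp_def z_object_def)
  have act_mult: "zext_act H V (p \<otimes> q) h w =
      ?s (?c p q h) (zext_act H V p (conj_by G q h) (zext_act H V q h w))"
    if p: "p \<in> H" and q: "q \<in> H" and h: "h \<in> carrier G" and w: "w \<in> zext_comp H V h" for p q h w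
  proof (cases "h \<in> H")
    case True
    then have "zact V (p \<otimes> q) h w =
        ?s (coc_act ?K \<alpha> p q h) (zact V p (conj_by ?K q h) (zact V q h w))"
      using V p q w by (simp add: z_object_def zext_comp_def)
    then show ?thesis
      using True p q h cjH[OF q h]
      by (simp add: zext_act_def coc_act_subgroup[OF H] conj_by_subgroup[OF H])
  qed (use cjH[OF q h] in \<open>simp add: zext_act_def\<close>)
  let ?w = "\<lambda>x. zext_act H V (inv x \<otimes> r) (conj_by G (inv r) f) v"
  \<comment> \<open>Moving the value at \<open>r\<close> by \<open>inv x \<otimes> r\<close>
    therefore lands in the degree prescribed for the value at \<open>x\<close>.\<close>
  have cj: "conj_by G (inv x \<otimes> r) (conj_by G (inv r) f) = conj_by G (inv x) f"
    if "x \<in> carrier G" for x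
    using that by (simp add: conj_by_mult[symmetric] m_assoc)
  have w: "?w x \<in> zext_comp H V (conj_by G (inv x) f)"
    if "x \<in> carrier G" "inv x \<otimes> r \<in> H" for x
    using act_closed[OF that(2) _ v] by (simp add: cj that)
  have zero: "0 \<in> zext_comp H V h" if "h \<in> carrier G" for h
    using V that V.subspace_0 by (auto simp: zext_comp_def z_object_def)
  have scale: "?s c w \<in> zext_comp H V h" if "w \<in> zext_comp H V h" for c w h
    using V that V.subspace_scale by (auto simp: zext_comp_def z_object_def split: if_splits)
  have act_zero: "zext_act H V p h 0 = 0" if "p \<in> H" "h \<in> carrier G" for p h
    using act_scale[OF that(1) zero[OF that(2)], of 0] by simp
  have eqv: "E_ext G H \<alpha> V f r v (x \<otimes> u) =
      ?s (?c (inv u) (inv x) f)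
        (zext_act H V (inv u) (conj_by G (inv x) f) (E_ext G H \<alpha> V f r v x))"
    if x[simp]: "x \<in> carrier G" and u: "u \<in> H" for x u
  proof -
    have uG[simp]: "u \<in> carrier G" using HG u .
    have as: "inv (x \<otimes> u) \<otimes> r = inv u \<otimes> (inv x \<otimes> r)"
      by (simp add: inv_mult_group m_assoc)
    show ?thesis
    proof (cases "inv x \<otimes> r \<in> H")
      case xr: True
      have "inv u \<otimes> (inv x \<otimes> r) \<in> H" using Hm Hinv u xr by blast
      then have "E_ext G H \<alpha> V f r v (x \<otimes> u) =
          ?s (?c (inv u \<otimes> (inv x \<otimes> r)) (inv r) f)
            (zext_act H V (inv u \<otimes> (inv x \<otimes> r)) (conj_by G (inv r) f) v)"
        by (simp add: E_ext_def as)
      also have "\<dots> = ?s (?c (inv u) (inv x \<otimes> r) (conj_by G (inv r) f) *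
          ?c (inv u \<otimes> (inv x \<otimes> r)) (inv r) f)
          (zext_act H V (inv u) (conj_by G (inv x) f) (?w x))"
        using act_mult[OF Hinv[OF u] xr _ v] by (simp add: cj mult.commute)
      also have "?c (inv u) (inv x \<otimes> r) (conj_by G (inv r) f) *
          ?c (inv u \<otimes> (inv x \<otimes> r)) (inv r) f =
          ?c (inv u) (inv x) f * ?c (inv x \<otimes> r) (inv r) f"
        by (subst coc_act_cocycle[OF \<alpha>]) (simp_all add: m_assoc)
      also have "?s \<dots> (zext_act H V (inv u) (conj_by G (inv x) f) (?w x)) =
          ?s (?c (inv u) (inv x) f) (zext_act H V (inv u) (conj_by G (inv x) f)
            (E_ext G H \<alpha> V f r v x))"
        using act_scale[OF Hinv[OF u] w[OF x xr]] xr by (simp add: E_ext_def)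
      finally show ?thesis .
    next
      case False
      \<comment> \<open>If \<open>x\<close> lies outside the coset of \<open>r\<close>, so does
        \<open>x \<otimes> u\<close>, and both sides vanish.\<close>
      have "inv x \<otimes> r = u \<otimes> (inv u \<otimes> (inv x \<otimes> r))"
        by (simp add: m_assoc[symmetric])
      then have "inv u \<otimes> (inv x \<otimes> r) \<notin> H"
        using False Hm[OF u] by metis
      then show ?thesis
        using False by (simp add: E_ext_def as act_zero Hinv u)
    qed
  qed
  show ?thesis
    unfolding E_comp_def using eqv w zero scale by (auto simp: E_ext_def)
qed


section \<open>Cosets and transversals\<close>

text \<open>Translates the support condition of \<open>E_ext\<close> into equality of
  cosets.\<close>

lemma (in group) l_coset_eq_iff:
  assumes H: "subgroup H G" and "x \<in> carrier G" "r \<in> carrier G"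
  shows "x <# H = r <# H \<longleftrightarrow> inv x \<otimes> r \<in> H"
proof
  assume *: "x <# H = r <# H"
  have "r \<otimes> \<one> \<in> r <# H"
    using subgroup.one_closed[OF H] by (auto simp: l_coset_def)
  then have "r \<in> x <# H"
    using * assms by simp
  then obtain h where "h \<in> H" "r = x \<otimes> h"
    by (auto simp: l_coset_def)
  then show "inv x \<otimes> r \<in> H"
    using assms subgroup.mem_carrier[OF H] by (simp add: m_assoc[symmetric])
next
  assume "inv x \<otimes> r \<in> H"
  then have "x \<otimes> (inv x \<otimes> r) \<in> x <# H"
    by (auto simp: l_coset_def)
  then have "r \<in> x <# H"
    using assms by (simp add: m_assoc[symmetric])
  then show "x <# H = r <# H"
    using assms by (intro l_repr_independence)
qed

text \<open>Adjoin one preimage for each value of \<open>q\<close> on \<open>X\<close> that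
  \<open>Y\<close> misses; the old and new values are disjoint, so \<open>q\<close> stays injective.
  With \<open>q\<close> the coset map this completes \<open>Y\<close> to representatives of all
  cosets in \<open>X\<close>.\<close>

lemma extend_to_transversal:
  assumes "Y \<subseteq> X" and "inj_on q Y"
  obtains R where "Y \<subseteq> R" "R \<subseteq> X" "inj_on q R" "q ` R = q ` X"
proof -
  have "q ` X - q ` Y \<subseteq> q ` X" by blast
  then obtain U where U: "U \<subseteq> X" "inj_on q U" "q ` X - q ` Y = q ` U"
    unfolding subset_image_inj by blast
  show ?thesis
  proof
    show "inj_on q (Y \<union> U)"
      using assms U by (auto simp: inj_on_Un)
  qed (use assms U in auto)
qed

section \<open>The character of \<open>L(H, \<gamma>)\<close>\<close>

theorem theorem5p8:
  fixes G :: "('g, 'm) monoid_scheme" (structure)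
    and \<alpha> :: "'g \<Rightarrow> 'g \<Rightarrow> 'g \<Rightarrow> 'k::{alg_closed_field, field_char_0}"
    and H :: "'g set" and \<gamma> :: "'g \<Rightarrow> 'g \<Rightarrow> 'k" and f g :: 'g and Y :: "'g set"
  assumes "group G" and "finite (carrier G)"
    and "normalised_3cocycle G \<alpha>"
    and "subgroup H G"
    and "normalised_2cochain (G\<lparr>carrier := H\<rparr>) \<gamma>"
    and "\<And>u v w. u \<in> H \<Longrightarrow> v \<in> H \<Longrightarrow> w \<in> H \<Longrightarrow>
           coboundary2 (G\<lparr>carrier := H\<rparr>) \<gamma> u v w = \<alpha> u v w"
    and "f \<in> carrier G" and "g \<in> carrier G" and "f \<otimes> g = g \<otimes> f"
    and "Y \<subseteq> carrier G"
    and "bij_betw (\<lambda>y. y <# H) Y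
           ((\<lambda>y. y <# H) ` {y \<in> carrier G. inv y \<otimes> f \<otimes> y \<in> H \<and> inv y \<otimes> g \<otimes> y \<in> H})"
  shows "zcharacter (L_alg G \<alpha> H \<gamma>) f g =
    (\<Sum>y\<in>Y.
      (coc_act G \<alpha> (inv y \<otimes> g \<otimes> y) (inv y) f * \<gamma> (inv y \<otimes> g \<otimes> y) (inv y \<otimes> f \<otimes> y)) /
      (coc_act G \<alpha> (inv y) g f * \<gamma> (inv y \<otimes> f \<otimes> y) (inv y \<otimes> g \<otimes> y)))"
proof -
  interpret group G by fact
  note \<alpha> = assms(3) and H = assms(4) and [simp] = assms(7,8) and Yc = assms(10) and bij = assms(11)
  let ?K = "G\<lparr>carrier := H\<rparr>"
  interpret K: group ?K using H by (rule subgroup_imp_group)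
  let ?V = "tw_group_alg ?K \<gamma>"
  let ?q = "\<lambda>y. y <# H"
  define f' where "f' = (\<lambda>y. inv y \<otimes> f \<otimes> y)"
  define g' where "g' = (\<lambda>y. inv y \<otimes> g \<otimes> y)"
  have cf: "conj_by G (inv y) f = f' y" if "y \<in> carrier G" for y
    using that by (simp add: conj_by_def f'_def)
  have V: "z_object ?K \<alpha> ?V"
    using assms(5,6) by (intro K.z_object_tw_group_alg) auto
  have L: "z_object G \<alpha> (L_alg G \<alpha> H \<gamma>)"
    using assms by (intro z_object_L_alg) auto
  let ?s = "\<lambda>(c::'k) (a::'g \<Rightarrow> 'g \<Rightarrow> 'k) x y. c * a x y"
  let ?S = "E_comp G H \<alpha> ?V f" and ?T = "E_act G \<alpha> ?V g f"
  have L_simps: "zscale (L_alg G \<alpha> H \<gamma>) = ?s" "zcomp (L_alg G \<alpha> H \<gamma>) = E_comp G H \<alpha> ?V"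
    "zact (L_alg G \<alpha> H \<gamma>) = E_act G \<alpha> ?V"
    by (simp_all add: L_alg_def E_alg_def tw_group_alg_def)
  interpret F: vector_space ?s
    using L by (simp add: z_object_def L_simps)
  \<comment> \<open>Commutation of \<open>f\<close> and \<open>g\<close> makes \<open>g\<close> act
    on the component of degree \<open>f\<close> by an endomorphism, as the trace requires.\<close>
  have gf: "conj_by G g f = f"
    using assms(9)[symmetric] by (simp add: conj_by_def m_assoc)

  have H_conj: "inv (x \<otimes> h) \<otimes> u \<otimes> (x \<otimes> h) \<in> H"
    if "inv x \<otimes> u \<otimes> x \<in> H" "x \<in> carrier G" "u \<in> carrier G" "h \<in> H" for x u h
  proof -
    have [simp]: "h \<in> carrier G" using subgroup.mem_carrier[OF H that(4)] .
    have "inv (x \<otimes> h) \<otimes> u \<otimes> (x \<otimes> h) = inv h \<otimes> (inv x \<otimes> u \<otimes> x) \<otimes> h"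
      using that by (simp add: inv_mult_group m_assoc)
    then show ?thesis
      using that H by (simp add: subgroup.m_closed subgroup.m_inv_closed)
  qed
  \<comment> \<open>The hypothesis on \<open>Y\<close> only says that the coset of \<open>y\<close>
    contains some \<open>x\<close> meeting both conditions. By \<open>H_conj\<close> these
    conditions depend only on the coset, so they pass from \<open>x\<close> to
    \<open>y\<close>.\<close>
  have Y_mem: "f' y \<in> H \<and> g' y \<in> H" if y: "y \<in> Y" for y
  proof -
    have "?q y \<in> ?q ` {y \<in> carrier G. f' y \<in> H \<and> g' y \<in> H}"
      using bij_betw_apply[OF bij y] by (simp only: f'_def g'_def)
    then obtain x where x: "x \<in> carrier G" "f' x \<in> H" "g' x \<in> H" "?q x = ?q y"
      by auto
    then have xy: "inv x \<otimes> y \<in> H"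
      using l_coset_eq_iff[OF H] Yc y by blast
    have "y = x \<otimes> (inv x \<otimes> y)"
      using x(1) Yc y by (simp add: m_assoc[symmetric] subsetD)
    then show ?thesis
      using H_conj[OF _ x(1) _ xy] x(2,3) unfolding f'_def g'_def by (metis assms(7,8))
  qed
  \<comment> \<open>The possible support of elements of degree \<open>f\<close>: elsewhere a value
    would have degree outside \<open>H\<close>, hence be zero.\<close>
  define X where "X = {x \<in> carrier G. f' x \<in> H}"
  have "Y \<subseteq> X" "inj_on ?q Y"
    using Y_mem Yc bij by (auto simp: X_def bij_betw_def)
  then obtain R where R: "Y \<subseteq> R" "R \<subseteq> X" "inj_on ?q R" "?q ` R = ?q ` X"
    by (rule extend_to_transversal)
  have RG: "r \<in> carrier G" "f' r \<in> H" if "r \<in> R" for r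
    using R(2) that by (auto simp: X_def)
  have finR: "finite R"
    using R(2) assms(2) by (auto simp: X_def intro: finite_subset)

  \<comment> \<open>By \<open>b_self\<close> and \<open>b_other\<close> below, these elements are
    dual to the evaluations \<open>a r (f' r)\<close>.\<close>
  define b where "b = (\<lambda>r. E_ext G H \<alpha> ?V f r (tw_basis (f' r)))"
  have v: "tw_basis (f' r) \<in> zext_comp H ?V (conj_by G (inv r) f)" if "r \<in> R" for r
    using RG[OF that] by (auto simp: cf zext_comp_def tw_group_alg_def intro: exI[of _ 1])
  have b_mem: "b r \<in> ?S" if "r \<in> R" for r
    unfolding b_def using RG that by (intro E_ext_closed[OF \<alpha> H V] v) auto
  have b_self: "b r r = tw_basis (f' r)" if "r \<in> R" for r
    unfolding b_def using RG that by (intro E_ext_self[OF \<alpha> H V] v) auto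
  have b_other: "b r t = 0" if "r \<in> R" "t \<in> R" "r \<noteq> t" for r t
  proof -
    have "inv t \<otimes> r \<notin> H"
      using inj_on_eq_iff[OF R(3) that(2,1)] that(3)
        l_coset_eq_iff[OF H RG(1)[OF that(2)] RG(1)[OF that(1)]]
      by blast
    then show ?thesis by (simp add: b_def E_ext_def)
  qed
  \<comment> \<open>The component of degree \<open>f' x\<close> is a line, so \<open>a x\<close> is
    recovered from its coefficient at \<open>f' x\<close>.\<close>
  have S_scalar: "a x = (\<lambda>y. a x (f' x) * tw_basis (f' x) y)" if "a \<in> ?S" "x \<in> X" for a x
  proof -
    have "a x \<in> zext_comp H ?V (conj_by G (inv x) f)"
      using that by (auto simp: E_comp_def X_def)
    then show ?thesis
      using that(2) by (auto simp: X_def cf zext_comp_def tw_group_alg_def tw_basis_def)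
  qed
  \<comment> \<open>Reduces the basis expansion to a check at the points of \<open>R\<close>:
    equivariance propagates values along each coset, and off \<open>X\<close> both functions
    vanish.\<close>
  have S_eqI: "a = c" if a: "a \<in> ?S" and c: "c \<in> ?S" and eq: "\<And>r. r \<in> R \<Longrightarrow> a r = c r" for a c
  proof
    fix x
    show "a x = c x"
    proof (cases "x \<in> X")
      case True
      then obtain r where r: "r \<in> R" "?q r = ?q x"
        using R(4) by (metis (no_types, lifting) imageE imageI)
      have xG: "x \<in> carrier G" using True by (simp add: X_def)
      define h where "h = inv r \<otimes> x"
      have h: "h \<in> H"
        using r xG RG l_coset_eq_iff[OF H] by (auto simp: h_def)
      have x: "x = r \<otimes> h"
        using xG RG[OF r(1)] by (simp add: h_def m_assoc[symmetric])
      show ?thesis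
        using a c h RG[OF r(1)] eq[OF r(1)] unfolding x E_comp_def by simp
    next
      case False
      have "e x = 0" if "e \<in> ?S" for e
      proof (cases "x \<in> carrier G")
        case True
        then have "e x \<in> zext_comp H ?V (f' x)"
          using that by (auto simp: E_comp_def cf)
        then show ?thesis
          using False True by (simp add: zext_comp_def X_def)
      qed (use that in \<open>simp add: E_comp_def\<close>)
      then show ?thesis using a c by simp
    qed
  qed
  have S: "F.subspace ?S"
    using L by (simp add: z_object_def L_simps)

  have "trace_on ?s ?S ?T = (\<Sum>r\<in>R. ?T (b r) r (f' r))"
  proof (rule F.trace_on_dual_basis[OF finR S])
    fix r assume "r \<in> R"
    then show "b r \<in> ?S" by (rule b_mem)
    show "Vector_Spaces.linear ?s (*) (\<lambda>a. a r (f' r))"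
      by unfold_locales (auto simp: algebra_simps)
  next
    fix r t assume "r \<in> R" "t \<in> R"
    then show "b r t (f' t) = (if r = t then 1 else 0)"
      using b_self b_other by (auto simp: tw_basis_def)
  next
    fix a assume a: "a \<in> ?S"
    show "a = (\<Sum>r\<in>R. ?s (a r (f' r)) (b r))"
    proof (rule S_eqI[OF a])
      show "(\<Sum>r\<in>R. ?s (a r (f' r)) (b r)) \<in> ?S"
        using b_mem by (intro F.subspace_sum F.subspace_scale S)
      fix t assume t: "t \<in> R"
      have app: "(\<Sum>r\<in>Q. c r) t y = (\<Sum>r\<in>Q. c r t y)" for Q y and c :: "'g \<Rightarrow> 'g \<Rightarrow> 'g \<Rightarrow> 'k"
        by (induction Q rule: infinite_finite_induct) auto
      show "a t = (\<Sum>r\<in>R. ?s (a r (f' r)) (b r)) t"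
      proof
        fix y
        have "(\<Sum>r\<in>R. ?s (a r (f' r)) (b r)) t y =
            (\<Sum>r\<in>R. if r = t then a t (f' t) * tw_basis (f' t) y else 0)"
          unfolding app using t b_self b_other by (intro sum.cong) auto
        also have "\<dots> = a t (f' t) * tw_basis (f' t) y"
          using finR t by simp
        also have "\<dots> = a t y"
          using fun_cong[OF S_scalar[OF a subsetD[OF R(2) t]]] by (rule sym)
        finally show "a t y = (\<Sum>r\<in>R. ?s (a r (f' r)) (b r)) t y" ..
      qed
    qed
  next
    fix a assume a: "a \<in> ?S"
    have "bij_betw ?T ?S (E_comp G H \<alpha> ?V (conj_by G g f))"
      using L by (simp add: z_object_def L_simps)
    then show "?T a \<in> ?S"
      using a by (simp add: gf bij_betw_apply)
    show "?T (?s c a) = ?s c (?T a)" for c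
      using L a by (simp add: z_object_def L_simps)
    show "?T (a + w) = ?T a + ?T w" if "w \<in> ?S" for w
      using L a that by (simp add: z_object_def L_simps)
  qed
  also have "\<dots> = (\<Sum>r\<in>R. if g' r \<in> H
      then (coc_act G \<alpha> (g' r) (inv r) f * \<gamma> (g' r) (f' r)) /
        (coc_act G \<alpha> (inv r) g f * \<gamma> (f' r) (g' r)) else 0)"
  proof (rule sum.cong[OF refl])
    fix r assume r: "r \<in> R"
    note [simp] = RG[OF r]
    \<comment> \<open>\<open>?T (b r)\<close> at \<open>r\<close> is a multiple of
      \<open>b r\<close> at \<open>inv g \<otimes> r\<close>. By this identity that point lies in
      the support coset exactly when \<open>g' r\<close> is in \<open>H\<close>, and the value there
      is obtained by acting with \<open>g' r\<close>.\<close>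
    have "inv (inv g \<otimes> r) \<otimes> r = g' r"
      by (simp add: g'_def inv_mult_group)
    \<comment> \<open>The action of \<open>g' r\<close> preserves the degree \<open>f' r\<close>, so
      it multiplies the basis vector by \<gamma>(g' r, f' r) / \<gamma>(f' r, g' r).\<close>
    moreover have "conj_by ?K (g' r) (f' r) = f' r" if "g' r \<in> H"
    proof -
      have "conj_by G (g' r) (f' r) = conj_by G (g' r \<otimes> inv r) f"
        by (simp add: conj_by_mult cf g'_def)
      also have "g' r \<otimes> inv r = inv r \<otimes> g"
        by (simp add: g'_def m_assoc)
      also have "conj_by G (inv r \<otimes> g) f = f' r"
        by (simp add: conj_by_mult gf cf)
      finally show ?thesis
        by (simp add: conj_by_subgroup[OF H that])
    qed
    ultimately show "?T (b r) r (f' r) = (if g' r \<in> H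
      then (coc_act G \<alpha> (g' r) (inv r) f * \<gamma> (g' r) (f' r)) /
        (coc_act G \<alpha> (inv r) g f * \<gamma> (f' r) (g' r)) else 0)"
      by (simp add: E_act_def b_def E_ext_def cf zext_act_def tw_group_alg_def tw_basis_def
          field_simps)
  qed
  also have "\<dots> = (\<Sum>r\<in>Y. (coc_act G \<alpha> (g' r) (inv r) f * \<gamma> (g' r) (f' r)) /
        (coc_act G \<alpha> (inv r) g f * \<gamma> (f' r) (g' r)))"
  proof (rule sum.mono_neutral_cong_right[OF finR R(1)])
    show "\<forall>r\<in>R - Y. (if g' r \<in> H
      then (coc_act G \<alpha> (g' r) (inv r) f * \<gamma> (g' r) (f' r)) /
        (coc_act G \<alpha> (inv r) g f * \<gamma> (f' r) (g' r)) else 0) = 0"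
    proof
      fix r assume r: "r \<in> R - Y"
      \<comment> \<open>Otherwise some element of \<open>Y\<close> would represent the coset of
        \<open>r\<close>; both lie in \<open>R\<close>, where cosets have only one representative,
        so \<open>r\<close> would be in \<open>Y\<close>.\<close>
      have "g' r \<notin> H"
      proof
        assume "g' r \<in> H"
        then have "?q r \<in> ?q ` {y \<in> carrier G. f' y \<in> H \<and> g' y \<in> H}"
          using r RG by auto
        then have "?q r \<in> ?q ` Y"
          using bij by (simp add: bij_betw_def f'_def g'_def)
        then show False
          using r R(1,3) by (auto simp: inj_on_def)
      qed
      then show "(if g' r \<in> H
        then (coc_act G \<alpha> (g' r) (inv r) f * \<gamma> (g' r) (f' r)) /
          (coc_act G \<alpha> (inv r) g f * \<gamma> (f' r) (g' r)) else 0) = 0"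
        by simp
    qed
  qed (use Y_mem in auto)
  finally show ?thesis
    by (simp add: zcharacter_def L_simps f'_def g'_def)
qed

end
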